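(* Let $f(t)=\sum_{k=0}^{5}a_kt^k$ be a univariate real polynomial with $a_k>0$ for $k=0,\dots,5$. Suppose that $$a_k^2>\frac{k+1}{k}\,a_{k-1}a_{k+1}\qquad\text{for }k=1,\dots,4,$$ and $$(a_1a_4-a_0a_5)^2<(a_1a_2-a_0a_3)(a_3a_4-a_2a_5).$$ Then $f(t)$ is Hurwitz-stable.
   Context: A univariate polynomial is Hurwitz-stable if all its (complex) roots have negative real part. *)

theory Defs
  imports Complex_Main "HOL-Computational_Algebra.Polynomial"
begin

definition hurwitz_stable :: "complex poly \<Rightarrow> bool" where
  "hurwitz_stable p \<longleftrightarrow> (\<forall>z. poly p z = 0 \<longrightarrow> Re z < 0)"

end

theory Submission
  imports Defs
begin

text \<open>
  Split \<open>f(z) = p + q\<close> into its odd part \<open>p\<close> and its even part \<open>q\<close>.  The Routh scheme, that is, the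
  Euclidean algorithm applied to the two parts, has the form
  \<open>p = c\<^sub>1 z q + r\<close>, \<open>q = c\<^sub>2 z r + s\<close>, and so on down to the constant \<open>a\<^sub>0\<close>.  If all the \<open>c\<^sub>i\<close> are
  positive and \<open>Re z \<ge> 0\<close>, then this continued fraction keeps the quotient \<open>p / q\<close> in the closed
  right half-plane of the Riemann sphere, so it is never \<open>-1\<close> and \<open>f(z) \<noteq> 0\<close>.
  Lemmas \<open>right_half_pair_step\<close> and \<open>right_half_pair_sum_nonzero\<close> express these two facts without
  dividing by a part that may vanish.

  The constants \<open>c\<^sub>i\<close> are quotients of consecutive leading coefficients in the scheme, so what
  has to be proved is that these leading coefficients are positive.  For degree five this follows
  from the positivity of \<open>a\<^sub>1 a\<^sub>2 - a\<^sub>0 a\<^sub>3\<close> and \<open>a\<^sub>3 a\<^sub>4 - a\<^sub>2 a\<^sub>5\<close> together with the last hypothesis,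
  which says that the fourth Hurwitz determinant is positive.
  The Newton-type inequalities imply log-concavity \<open>a\<^sub>k\<^sup>2 > a\<^sub>k\<^sub>-\<^sub>1 a\<^sub>k\<^sub>+\<^sub>1\<close>, and this gives the two
  positivity conditions: multiply the inequalities for two neighbouring indices and cancel
  \<open>a\<^sub>k a\<^sub>k\<^sub>+\<^sub>1\<close> to get \<open>a\<^sub>k a\<^sub>k\<^sub>+\<^sub>1 > a\<^sub>k\<^sub>-\<^sub>1 a\<^sub>k\<^sub>+\<^sub>2\<close>.
\<close>

text \<open>
  The pair stands for a point \<open>p / q\<close> of the closed right half-plane with the point at infinity
  added; \<open>p / q\<close> and \<open>p * cnj q\<close> have real parts of the same sign.
\<close>

definition right_half_pair :: "complex \<Rightarrow> complex \<Rightarrow> bool" where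
  "right_half_pair p q \<longleftrightarrow> 0 \<le> Re (p * cnj q) \<and> (p \<noteq> 0 \<or> q \<noteq> 0)"

text \<open>
  In terms of quotients this is \<open>p / q = c z + 1 / (q / r)\<close>: inversion maps the right half-plane
  to itself, and so does adding \<open>c z\<close>.
\<close>

lemma right_half_pair_step:
  assumes "right_half_pair q r" and "0 \<le> Re z" and "0 \<le> c"
    and p: "p = of_real c * z * q + r"
  shows "right_half_pair p q"
proof -
  have "Re (p * cnj q) = c * Re z * ((Re q)\<^sup>2 + (Im q)\<^sup>2) + Re (q * cnj r)"
    unfolding p by (simp add: algebra_simps power2_eq_square)
  moreover have "0 \<le> c * Re z * ((Re q)\<^sup>2 + (Im q)\<^sup>2)"
    using assms(2,3) by simp
  ultimately show ?thesis
    using assms(1) p unfolding right_half_pair_def by auto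
qed

lemma right_half_pair_sum_nonzero:
  assumes "right_half_pair p q"
  shows "p + q \<noteq> 0"
proof
  assume "p + q = 0"
  hence p: "p = - q"
    by (simp add: eq_neg_iff_add_eq_0)
  hence "(Re q)\<^sup>2 + (Im q)\<^sup>2 \<le> 0"
    using assms unfolding right_half_pair_def by (simp add: power2_eq_square)
  hence "q = 0"
    by (simp add: complex_eq_iff sum_power2_le_zero_iff)
  with p assms show False
    unfolding right_half_pair_def by simp
qed

text \<open>
  This is the case of degree five of the criterion of Lienard and Chipart.  The Routh scheme for
  the odd part \<open>a5 z\<^sup>5 + a3 z\<^sup>3 + a1 z\<close> and the even part \<open>a4 z\<^sup>4 + a2 z\<^sup>2 + a0\<close> has the further
  rows \<open>b3 z\<^sup>3 + b1 z\<close>, \<open>d z\<^sup>2 + a0\<close>, \<open>e z\<close> and \<open>a0\<close>, where \<open>b3\<close>, \<open>d\<close> and \<open>e\<close> are quotients of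
  consecutive Hurwitz determinants.
\<close>

lemma quintic_nonzero_right_half_plane:
  fixes a0 a1 a2 a3 a4 a5 :: real and z :: complex
  assumes pos: "0 < a0" "0 < a2" "0 < a4" "0 < a5"
    and A_pos: "0 < a1 * a2 - a0 * a3"
    and B_pos: "0 < a3 * a4 - a2 * a5"
    and det: "(a1 * a4 - a0 * a5)\<^sup>2 < (a1 * a2 - a0 * a3) * (a3 * a4 - a2 * a5)"
    and z: "0 \<le> Re z"
  shows "a0 + a1 * z + a2 * z^2 + a3 * z^3 + a4 * z^4 + a5 * z^5 \<noteq> 0"
proof -
  define A where "A = a1 * a2 - a0 * a3"
  define B where "B = a3 * a4 - a2 * a5"
  define D where "D = a1 * a4 - a0 * a5"
  define b3 where "b3 = B / a4"
  define b1 where "b1 = D / a4"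
  define d where "d = a2 - a4 * b1 / b3"
  define e where "e = b1 - b3 * a0 / d"
  have B: "0 < B" and b3: "0 < b3"
    using B_pos pos by (simp_all add: B_def b3_def)
  have D_A_B: "a2 * D = a4 * A + a0 * B"
    by (simp add: A_def B_def D_def algebra_simps)
  have "0 < a2 * D"
    unfolding D_A_B using pos A_pos B by (simp add: A_def add_pos_pos)
  hence D: "0 < D"
    using pos by (simp add: zero_less_mult_iff)
  \<comment> \<open>Here \<open>a2 * B - a4 * D\<close> is the third Hurwitz determinant; by \<open>D_A_B\<close>, the
    difference of the two sides is \<open>a4\<close> times the fourth one.\<close>
  have key: "a0 * B\<^sup>2 < D * (a2 * B - a4 * D)"
  proof -
    have "D * (a2 * B - a4 * D) - a0 * B\<^sup>2 = (a2 * D - a0 * B) * B - a4 * D\<^sup>2"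
      by (simp add: algebra_simps power2_eq_square)
    also have "\<dots> = a4 * (A * B - D\<^sup>2)"
      unfolding D_A_B by (simp add: algebra_simps)
    also have "\<dots> > 0"
      using pos det by (simp add: A_def B_def D_def)
    finally show ?thesis by simp
  qed
  have "0 < D * (a2 * B - a4 * D)"
    using key pos by (smt (verit) mult_nonneg_nonneg zero_le_power2)
  hence det3: "0 < a2 * B - a4 * D"
    using D by (simp add: zero_less_mult_iff)
  have d_eq: "d = (a2 * B - a4 * D) / B"
    using B pos by (simp add: d_def b1_def b3_def field_simps)
  have d: "0 < d"
    unfolding d_eq using det3 B by simp
  have "e = (D * (a2 * B - a4 * D) - a0 * B\<^sup>2) / (a4 * (a2 * B - a4 * D))"
    unfolding e_def d_eq b1_def b3_def using pos B det3
    by (simp add: field_simps power2_eq_square)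
  hence e: "0 < e"
    using key pos det3 by simp
  have row5: "right_half_pair (of_real e * z) (of_real a0)"
    using pos e z by (simp add: right_half_pair_def)
  have row4: "right_half_pair (of_real d * z^2 + of_real a0) (of_real e * z)"
    by (rule right_half_pair_step[OF row5 z, of "d / e"])
      (use d e in \<open>simp_all add: power2_eq_square\<close>)
  have row3: "right_half_pair (of_real b3 * z^3 + of_real b1 * z) (of_real d * z^2 + of_real a0)"
    by (rule right_half_pair_step[OF row4 z, of "b3 / d"])
      (use b3 d in \<open>simp_all add: e_def field_simps power2_eq_square power3_eq_cube\<close>)
  have row2: "right_half_pair (of_real a4 * z^4 + of_real a2 * z^2 + of_real a0)
      (of_real b3 * z^3 + of_real b1 * z)"
    by (rule right_half_pair_step[OF row3 z, of "a4 / b3"])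
      (use b3 pos in \<open>simp_all add: d_def field_simps eval_nat_numeral\<close>)
  have row1: "right_half_pair (of_real a5 * z^5 + of_real a3 * z^3 + of_real a1 * z)
      (of_real a4 * z^4 + of_real a2 * z^2 + of_real a0)"
    by (rule right_half_pair_step[OF row2 z, of "a5 / a4"])
      (use pos in \<open>simp_all add: b1_def b3_def B_def D_def field_simps eval_nat_numeral\<close>)
  from right_half_pair_sum_nonzero[OF row1] show ?thesis
    by (simp add: algebra_simps)
qed

lemma mult_less_of_less_power2:
  fixes x y u v :: real
  assumes "0 < x" "0 < y" "0 < u" "0 < v"
    and "u * y < x\<^sup>2" and "x * v < y\<^sup>2"
  shows "u * v < x * y"
proof -
  have "(u * y) * (x * v) < x\<^sup>2 * y\<^sup>2"
    using assms by (intro mult_strict_mono) auto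
  hence "(x * y) * (u * v) < (x * y) * (x * y)"
    by (simp add: power2_eq_square mult_ac)
  thus ?thesis
    using assms by simp
qed

theorem theorem4p17:
  fixes a :: "nat \<Rightarrow> real" and f :: "real poly"
  assumes f_def: "f = (\<Sum>k=0..5. monom (a k) k)"
    and pos: "\<And>k. k \<in> {0..5} \<Longrightarrow> a k > 0"
    and newton: "\<And>k. k \<in> {1..4} \<Longrightarrow>
      (a k)^2 > real (k + 1) / real k * a (k - 1) * a (k + 1)"
    and hurwitz: "(a 1 * a 4 - a 0 * a 5)^2 < (a 1 * a 2 - a 0 * a 3) * (a 3 * a 4 - a 2 * a 5)"
  shows "hurwitz_stable (map_poly complex_of_real f)"
proof -
  have p: "0 < a 0" "0 < a 1" "0 < a 2" "0 < a 3" "0 < a 4" "0 < a 5"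
    using pos by auto
  have log_concave: "a (k - 1) * a (k + 1) < (a k)\<^sup>2" if k: "k \<in> {1..4}" for k
  proof -
    have "0 < a (k - 1) * a (k + 1)"
      using k by (intro mult_pos_pos pos) auto
    moreover have "1 \<le> real (k + 1) / real k"
      using k by (simp add: field_simps)
    ultimately have "1 * (a (k - 1) * a (k + 1)) \<le> real (k + 1) / real k * (a (k - 1) * a (k + 1))"
      by (intro mult_right_mono) auto
    with newton[OF k] show ?thesis by (simp add: mult.assoc)
  qed
  have lc: "a 0 * a 2 < (a 1)\<^sup>2" "a 1 * a 3 < (a 2)\<^sup>2" "a 2 * a 4 < (a 3)\<^sup>2" "a 3 * a 5 < (a 4)\<^sup>2"
    using log_concave[of 1] log_concave[of 2] log_concave[of 3] log_concave[of 4]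
    by (simp_all add: numeral_2_eq_2[symmetric])
  have A: "0 < a 1 * a 2 - a 0 * a 3"
    using mult_less_of_less_power2[OF p(2,3,1,4) lc(1,2)] by simp
  have B: "0 < a 3 * a 4 - a 2 * a 5"
    using mult_less_of_less_power2[OF p(4,5,3,6) lc(3,4)] by simp
  have poly_f: "poly (map_poly complex_of_real f) z =
      a 0 + a 1 * z + a 2 * z^2 + a 3 * z^3 + a 4 * z^4 + a 5 * z^5" for z :: complex
  proof -
    have "map_poly complex_of_real f = (\<Sum>k=0..5. monom (complex_of_real (a k)) k)"
      unfolding f_def by (intro poly_eqI) (simp add: coeff_map_poly coeff_sum)
    thus ?thesis
      by (simp add: poly_sum poly_monom eval_nat_numeral)
  qed
  show ?thesis
    unfolding hurwitz_stable_def
  proof (intro allI impI)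
    fix z assume "poly (map_poly complex_of_real f) z = 0"
    with quintic_nonzero_right_half_plane[OF p(1,3,5,6) A B hurwitz, of z] show "Re z < 0"
      unfolding poly_f by force
  qed
qed

end
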